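(* Let $\mathcal I$ be any non-empty totally ordered set. Then $\ell^1(\mathcal I_\vee)$ is boundedly approximately contractible.
   Context: For a non-empty totally ordered set $\mathcal I$, $\mathcal I_\vee$ denotes $\mathcal I$ regarded as a commutative semigroup with product $st=\max(s,t)$. $\ell^1(\mathcal I_\vee)$ is the $\ell^1$-convolution algebra of this semigroup: with $e_t$ denoting the point mass at $t$, multiplication satisfies $e_se_t=e_{\max(s,t)}$. A Banach algebra $A$ is boundedly approximately contractible if for every Banach $A$-bimodule $X$ and every continuous derivation $D:A\to X$ there is a net $(D_i)$ of inner derivations $A\to X$, bounded in operator norm, with $D_i(a)\to D(a)$ in norm for all $a\in A$. *)

theory Defs
  imports "HOL-Analysis.Infinite_Sum" "HOL-Analysis.Operator_Norm"
begin

section \<open>Complex Banach spaces and Banach algebras\<close>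

class complex_normed_vector = real_normed_vector +
  fixes scaleC :: "complex \<Rightarrow> 'a \<Rightarrow> 'a"
  assumes scaleC_add_right: "scaleC c (x + y) = scaleC c x + scaleC c y"
    and scaleC_add_left: "scaleC (c + d) x = scaleC c x + scaleC d x"
    and scaleC_scaleC: "scaleC c (scaleC d x) = scaleC (c * d) x"
    and scaleC_of_real: "scaleC (complex_of_real r) x = r *\<^sub>R x"
    and norm_scaleC: "norm (scaleC c x) = cmod c * norm x"

class complex_banach = complex_normed_vector + banach

text \<open>Not necessarily unital.\<close>

class complex_banach_algebra = complex_banach + real_normed_algebra +
  assumes mult_scaleC_left: "scaleC c x * y = scaleC c (x * y)"
    and mult_scaleC_right: "x * scaleC c y = scaleC c (x * y)"

instantiation complex :: complex_banach_algebra
begin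

definition scaleC_complex :: "complex \<Rightarrow> complex \<Rightarrow> complex"
  where "scaleC_complex c x = c * x"

instance
  by standard (auto simp: scaleC_complex_def algebra_simps norm_mult scaleR_conv_of_real)

end

section \<open>Banach bimodules, derivations, bounded approximate contractibility\<close>

locale banach_bimodule = lact: bounded_bilinear lact + ract: bounded_bilinear ract
  for lact :: "'a::complex_banach_algebra \<Rightarrow> 'x::complex_banach \<Rightarrow> 'x"
    and ract :: "'x \<Rightarrow> 'a \<Rightarrow> 'x" +
  assumes lact_scaleC_left: "lact (scaleC c a) x = scaleC c (lact a x)"
    and lact_scaleC_right: "lact a (scaleC c x) = scaleC c (lact a x)"
    and ract_scaleC_left: "ract (scaleC c x) a = scaleC c (ract x a)"
    and ract_scaleC_right: "ract x (scaleC c a) = scaleC c (ract x a)"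
    and lact_mult: "lact (a * b) x = lact a (lact b x)"
    and ract_mult: "ract x (a * b) = ract (ract x a) b"
    and lact_ract: "ract (lact a x) b = lact a (ract x b)"

definition continuous_derivation ::
  "('a::complex_banach_algebra \<Rightarrow> 'x::complex_banach \<Rightarrow> 'x) \<Rightarrow> ('x \<Rightarrow> 'a \<Rightarrow> 'x) \<Rightarrow> ('a \<Rightarrow> 'x) \<Rightarrow> bool"
  where "continuous_derivation lact ract D \<longleftrightarrow>
    bounded_linear D \<and> (\<forall>c a. D (scaleC c a) = scaleC c (D a)) \<and>
    (\<forall>a b. D (a * b) = lact a (D b) + ract (D a) b)"

definition inner_derivation ::
  "('a::complex_banach_algebra \<Rightarrow> 'x::complex_banach \<Rightarrow> 'x) \<Rightarrow> ('x \<Rightarrow> 'a \<Rightarrow> 'x) \<Rightarrow> ('a \<Rightarrow> 'x) \<Rightarrow> bool"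
  where "inner_derivation lact ract D \<longleftrightarrow> (\<exists>x. \<forall>a. D a = lact a x - ract x a)"

definition directed_set :: "'j set \<Rightarrow> ('j \<Rightarrow> 'j \<Rightarrow> bool) \<Rightarrow> bool"
  where "directed_set J le \<longleftrightarrow> J \<noteq> {} \<and> (\<forall>i\<in>J. le i i) \<and>
    (\<forall>i\<in>J. \<forall>j\<in>J. \<forall>k\<in>J. le i j \<longrightarrow> le j k \<longrightarrow> le i k) \<and>
    (\<forall>i\<in>J. \<forall>j\<in>J. \<exists>k\<in>J. le i k \<and> le j k)"

definition net_tendsto ::
  "'j set \<Rightarrow> ('j \<Rightarrow> 'j \<Rightarrow> bool) \<Rightarrow> ('j \<Rightarrow> 'x::real_normed_vector) \<Rightarrow> 'x \<Rightarrow> bool"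
  where "net_tendsto J le f l \<longleftrightarrow>
    (\<forall>e>0. \<exists>i\<in>J. \<forall>j\<in>J. le i j \<longrightarrow> norm (f j - l) < e)"

text \<open>
  HOL cannot quantify over types inside a definition. The type of the bimodule is therefore a
  parameter; a theorem in which it is a free type variable covers every Banach bimodule.

  The directed index sets are subsets of a fixed type. This loses no generality: given a net of
  any size converging pointwise to a derivation, choose for every finite set of algebra elements
  and every positive integer \<open>n\<close> one member of the net that is \<open>1/n\<close>-close to the derivation on
  that finite set; these choices form a net of the same kind, indexed by pairs.
\<close>

definition boundedly_approx_contractible ::
  "'a::complex_banach_algebra itself \<Rightarrow> 'x::complex_banach itself \<Rightarrow> bool"
  where "boundedly_approx_contractible (_ :: 'a itself) (_ :: 'x itself) \<longleftrightarrow>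
    (\<forall>(lact :: 'a \<Rightarrow> 'x \<Rightarrow> 'x) (ract :: 'x \<Rightarrow> 'a \<Rightarrow> 'x) (D :: 'a \<Rightarrow> 'x).
      banach_bimodule lact ract \<longrightarrow> continuous_derivation lact ract D \<longrightarrow>
      (\<exists>(J :: ('a set \<times> nat) set) le (N :: 'a set \<times> nat \<Rightarrow> 'a \<Rightarrow> 'x).
        directed_set J le \<and>
        (\<forall>j\<in>J. inner_derivation lact ract (N j)) \<and>
        (\<exists>K. \<forall>j\<in>J. onorm (N j) \<le> K) \<and>
        (\<forall>a. net_tendsto J le (\<lambda>j. N j a) (D a))))"

section \<open>The convolution algebra of a semigroup\<close>

typedef 's ell1 = "{f :: 's \<Rightarrow> complex. f abs_summable_on UNIV}"
  morphisms ell1_fun Abs_ell1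
  by (rule exI[of _ "\<lambda>_. 0"]) simp

setup_lifting type_definition_ell1

lemma ell1_summable: "ell1_fun f abs_summable_on A"
  using ell1_fun[of f] summable_on_subset_banach[of "\<lambda>x. norm (ell1_fun f x)" UNIV A] by simp

lemma ell1_eqI: "(\<And>t. ell1_fun f t = ell1_fun g t) \<Longrightarrow> f = g"
  by (metis ell1_fun_inject ext)

lemma abs_summable_add:
  fixes f g :: "'s \<Rightarrow> 'b::real_normed_vector"
  assumes "f abs_summable_on A" "g abs_summable_on A"
  shows "(\<lambda>t. f t + g t) abs_summable_on A"
  by (rule summable_on_comparison_test[OF summable_on_add[OF assms]]) (auto intro: norm_triangle_ineq)

lemma abs_summable_cmult:
  fixes f :: "'s \<Rightarrow> complex"
  assumes "f abs_summable_on A"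
  shows "(\<lambda>t. c * f t) abs_summable_on A"
  using summable_on_cmult_right[OF assms, of "norm c"] by (simp add: norm_mult)

instantiation ell1 :: (type) complex_normed_vector
begin

lift_definition zero_ell1 :: "'a ell1" is "\<lambda>_. 0" by simp

lift_definition plus_ell1 :: "'a ell1 \<Rightarrow> 'a ell1 \<Rightarrow> 'a ell1" is "\<lambda>f g t. f t + g t"
  using abs_summable_add by blast

lift_definition uminus_ell1 :: "'a ell1 \<Rightarrow> 'a ell1" is "\<lambda>f t. - f t" by simp

definition minus_ell1 :: "'a ell1 \<Rightarrow> 'a ell1 \<Rightarrow> 'a ell1" where "minus_ell1 f g = f + - g"

lift_definition scaleC_ell1 :: "complex \<Rightarrow> 'a ell1 \<Rightarrow> 'a ell1" is "\<lambda>c f t. c * f t"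
  using abs_summable_cmult by blast

definition scaleR_ell1 :: "real \<Rightarrow> 'a ell1 \<Rightarrow> 'a ell1"
  where "scaleR_ell1 r f = scaleC (complex_of_real r) f"

lift_definition norm_ell1 :: "'a ell1 \<Rightarrow> real" is "\<lambda>f. \<Sum>\<^sub>\<infinity>t. norm (f t)" .

definition sgn_ell1 :: "'a ell1 \<Rightarrow> 'a ell1" where "sgn_ell1 f = inverse (norm f) *\<^sub>R f"

definition dist_ell1 :: "'a ell1 \<Rightarrow> 'a ell1 \<Rightarrow> real" where "dist_ell1 f g = norm (f - g)"

definition uniformity_ell1 :: "('a ell1 \<times> 'a ell1) filter"
  where "uniformity_ell1 = (INF e\<in>{0 <..}. principal {(x, y). dist x y < e})"

definition open_ell1 :: "'a ell1 set \<Rightarrow> bool"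
  where "open_ell1 S = (\<forall>x\<in>S. \<forall>\<^sub>F (x', y) in uniformity. x' = x \<longrightarrow> y \<in> S)"

instance
proof
  fix f g h :: "'a ell1" and r s :: real and c d :: complex
  show "f + g + h = f + (g + h)" by transfer (simp add: add.assoc)
  show "f + g = g + f" by transfer (simp add: add.commute)
  show "0 + f = f" by transfer simp
  show "- f + f = 0" by transfer simp
  show "f - g = f + - g" by (simp add: minus_ell1_def)
  show "r *\<^sub>R (f + g) = r *\<^sub>R f + r *\<^sub>R g"
    unfolding scaleR_ell1_def by transfer (simp add: algebra_simps)
  show "(r + s) *\<^sub>R f = r *\<^sub>R f + s *\<^sub>R f"
    unfolding scaleR_ell1_def by transfer (simp add: algebra_simps)
  show "r *\<^sub>R s *\<^sub>R f = (r * s) *\<^sub>R f"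
    unfolding scaleR_ell1_def by transfer (simp add: algebra_simps)
  show "1 *\<^sub>R f = f"
    unfolding scaleR_ell1_def by transfer simp
  show "scaleC c (f + g) = scaleC c f + scaleC c g" by transfer (simp add: algebra_simps)
  show "scaleC (c + d) f = scaleC c f + scaleC d f" by transfer (simp add: algebra_simps)
  show "scaleC c (scaleC d f) = scaleC (c * d) f" by transfer (simp add: algebra_simps)
  show "scaleC (complex_of_real r) f = r *\<^sub>R f" by (simp add: scaleR_ell1_def)
  show normC: "norm (scaleC c f) = cmod c * norm f" for c
    by transfer (simp add: norm_mult infsum_cmult_right')
  show "sgn f = inverse (norm f) *\<^sub>R f" by (simp add: sgn_ell1_def)
  show "dist f g = norm (f - g)" by (simp add: dist_ell1_def)
  show "(uniformity :: ('a ell1 \<times> 'a ell1) filter) = (INF e\<in>{0 <..}. principal {(x, y). dist x y < e})"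
    by (simp add: uniformity_ell1_def)
  show "open U \<longleftrightarrow> (\<forall>x\<in>U. \<forall>\<^sub>F (x', y) in uniformity. x' = x \<longrightarrow> y \<in> U)" for U :: "'a ell1 set"
    by (simp add: open_ell1_def)
  show "norm f = 0 \<longleftrightarrow> f = 0"
  proof transfer
    fix f :: "'a \<Rightarrow> complex" assume "f abs_summable_on UNIV"
    then have "norm (f t) = 0" if "(\<Sum>\<^sub>\<infinity>t. norm (f t)) = 0" for t
      using nonneg_infsum_le_0D[of "\<lambda>t. norm (f t)" UNIV t] that by simp
    then show "((\<Sum>\<^sub>\<infinity>t. norm (f t)) = 0) \<longleftrightarrow> (f = (\<lambda>_. 0))" by (auto simp: fun_eq_iff)
  qed
  show "norm (f + g) \<le> norm f + norm g"
  proof transfer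
    fix f g :: "'a \<Rightarrow> complex"
    assume f: "f abs_summable_on UNIV" and g: "g abs_summable_on UNIV"
    have "(\<Sum>\<^sub>\<infinity>t. norm (f t + g t)) \<le> (\<Sum>\<^sub>\<infinity>t. norm (f t) + norm (g t))"
      by (intro infsum_mono abs_summable_add f g summable_on_add norm_triangle_ineq)
    also have "\<dots> = (\<Sum>\<^sub>\<infinity>t. norm (f t)) + (\<Sum>\<^sub>\<infinity>t. norm (g t))"
      by (rule infsum_add[OF f g])
    finally show "(\<Sum>\<^sub>\<infinity>t. norm (f t + g t)) \<le> (\<Sum>\<^sub>\<infinity>t. norm (f t)) + (\<Sum>\<^sub>\<infinity>t. norm (g t))" .
  qed
  show "norm (r *\<^sub>R f) = \<bar>r\<bar> * norm f" unfolding scaleR_ell1_def normC by simp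
qed

end

lemma ell1_fun_diff: "ell1_fun (f - g) t = ell1_fun f t - ell1_fun g t"
  unfolding minus_ell1_def plus_ell1.rep_eq uminus_ell1.rep_eq by simp

lemma sum_norm_le_norm_ell1: "finite F \<Longrightarrow> (\<Sum>t\<in>F. norm (ell1_fun f t)) \<le> norm f"
  unfolding norm_ell1.rep_eq by (rule finite_sum_le_infsum) (auto intro: ell1_summable)

lemma norm_ell1_leI:
  assumes "\<And>F. finite F \<Longrightarrow> (\<Sum>t\<in>F. norm (ell1_fun f t)) \<le> C"
  shows "norm f \<le> C"
  unfolding norm_ell1.rep_eq by (rule infsum_le_finite_sums) (auto intro: ell1_summable assms)

instance ell1 :: (type) complex_banach
proof
  fix X :: "nat \<Rightarrow> 'a ell1"
  assume C: "Cauchy X"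
  have C': "\<exists>N. \<forall>m\<ge>N. \<forall>n\<ge>N. norm (X m - X n) < e" if "e > 0" for e
    using C that by (simp add: Cauchy_iff)
  have "convergent (\<lambda>n. ell1_fun (X n) t)" for t
  proof -
    have le: "norm (ell1_fun (X m) t - ell1_fun (X n) t) \<le> norm (X m - X n)" for m n
      using sum_norm_le_norm_ell1[of "{t}" "X m - X n"] by (simp add: ell1_fun_diff)
    have "Cauchy (\<lambda>n. ell1_fun (X n) t)"
      unfolding Cauchy_iff using C' le by (meson le_less_trans)
    then show ?thesis by (simp add: Cauchy_convergent_iff)
  qed
  then obtain g where g: "\<And>t. (\<lambda>n. ell1_fun (X n) t) \<longlonglongrightarrow> g t"
    unfolding convergent_def by metis
  have bound: "(\<Sum>t\<in>F. norm (g t - ell1_fun (X n) t)) \<le> e"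
    if N: "\<And>m n. m \<ge> N \<Longrightarrow> n \<ge> N \<Longrightarrow> norm (X m - X n) < e" and "n \<ge> N" "finite F" for N n e F
  proof (rule tendsto_upperbound)
    show "(\<lambda>m. \<Sum>t\<in>F. norm (ell1_fun (X m) t - ell1_fun (X n) t))
        \<longlonglongrightarrow> (\<Sum>t\<in>F. norm (g t - ell1_fun (X n) t))"
      by (intro tendsto_intros g)
    show "\<forall>\<^sub>F m in sequentially. (\<Sum>t\<in>F. norm (ell1_fun (X m) t - ell1_fun (X n) t)) \<le> e"
      using eventually_ge_at_top[of N]
    proof eventually_elim
      case (elim m)
      show ?case
        using sum_norm_le_norm_ell1[OF \<open>finite F\<close>, of "X m - X n"] N[OF elim \<open>n \<ge> N\<close>]
        by (simp add: ell1_fun_diff)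
    qed
  qed simp
  have g_summable: "g abs_summable_on UNIV"
  proof -
    obtain N where N: "\<And>m n. m \<ge> N \<Longrightarrow> n \<ge> N \<Longrightarrow> norm (X m - X n) < 1"
      using C'[of 1] by auto
    have "(\<lambda>t. g t - ell1_fun (X N) t) abs_summable_on UNIV"
      by (rule nonneg_bdd_above_summable_on)
        (use bound[OF N order_refl] in \<open>auto intro!: bdd_aboveI\<close>)
    from abs_summable_add[OF this ell1_summable[of "X N"]] show ?thesis by simp
  qed
  define G where "G = Abs_ell1 g"
  have G: "ell1_fun G = g" unfolding G_def using g_summable by (simp add: Abs_ell1_inverse)
  have "X \<longlonglongrightarrow> G"
  proof (rule LIMSEQ_I)
    fix e :: real assume "e > 0"
    then obtain N where N: "\<And>m n. m \<ge> N \<Longrightarrow> n \<ge> N \<Longrightarrow> norm (X m - X n) < e / 2"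
      using C'[of "e / 2"] by auto
    have "norm (X n - G) < e" if "n \<ge> N" for n
    proof -
      have "norm (G - X n) \<le> e / 2"
        by (rule norm_ell1_leI) (use bound[OF N that] in \<open>simp add: ell1_fun_diff G\<close>)
      then show ?thesis using \<open>e > 0\<close> by (simp add: norm_minus_commute)
    qed
    then show "\<exists>N. \<forall>n\<ge>N. norm (X n - G) < e" by blast
  qed
  then show "convergent X" by (auto simp: convergent_def)
qed

lemma abs_summable_times:
  fixes f :: "'s \<Rightarrow> complex" and g :: "'t \<Rightarrow> complex"
  assumes f: "f abs_summable_on UNIV" and g: "g abs_summable_on UNIV"
  shows "(\<lambda>(r, s). f r * g s) abs_summable_on UNIV"
    and "(\<Sum>\<^sub>\<infinity>(r, s). norm (f r * g s)) = (\<Sum>\<^sub>\<infinity>r. norm (f r)) * (\<Sum>\<^sub>\<infinity>s. norm (g s))"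
proof -
  have "(\<lambda>(r, s). norm (f r * g s)) summable_on (SIGMA r:UNIV. UNIV)"
  proof (rule summable_on_SigmaI[where g = "\<lambda>r. norm (f r) * (\<Sum>\<^sub>\<infinity>s. norm (g s))"])
    show "((\<lambda>s. case (r, s) of (r, s) \<Rightarrow> norm (f r * g s)) has_sum norm (f r) * (\<Sum>\<^sub>\<infinity>s. norm (g s))) UNIV"
      for r using has_sum_cmult_right[OF has_sum_infsum[OF g], of "norm (f r)"] by (simp add: norm_mult)
  qed (auto intro: summable_on_cmult_left f)
  then have s: "(\<lambda>(r, s). norm (f r * g s)) summable_on UNIV \<times> UNIV" by simp
  then show "(\<lambda>(r, s). f r * g s) abs_summable_on UNIV" by (simp add: case_prod_unfold)
  show "(\<Sum>\<^sub>\<infinity>(r, s). norm (f r * g s)) = (\<Sum>\<^sub>\<infinity>r. norm (f r)) * (\<Sum>\<^sub>\<infinity>s. norm (g s))"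
    using infsum_Sigma'_banach[OF s]
    by (simp add: norm_mult infsum_cmult_right' infsum_cmult_left')
qed

lemma summable_fibres:
  fixes F :: "'p \<Rightarrow> real"
  assumes "F summable_on UNIV"
  shows "(\<lambda>t. \<Sum>\<^sub>\<infinity>p\<in>{p. h p = t}. F p) summable_on UNIV"
    and "(\<Sum>\<^sub>\<infinity>t. \<Sum>\<^sub>\<infinity>p\<in>{p. h p = t}. F p) = (\<Sum>\<^sub>\<infinity>p. F p)"
proof -
  have bij: "bij_betw snd (SIGMA t:UNIV. {p. h p = t}) UNIV"
    by (rule bij_betw_byWitness[where f' = "\<lambda>p. (h p, p)"]) auto
  have s: "(\<lambda>(t, p). F p) summable_on (SIGMA t:UNIV. {p. h p = t})"
    using summable_on_reindex_bij_betw[OF bij, of F] assms by (simp add: case_prod_unfold)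
  show "(\<lambda>t. \<Sum>\<^sub>\<infinity>p\<in>{p. h p = t}. F p) summable_on UNIV"
    using summable_on_Sigma_banach[OF s] by simp
  show "(\<Sum>\<^sub>\<infinity>t. \<Sum>\<^sub>\<infinity>p\<in>{p. h p = t}. F p) = (\<Sum>\<^sub>\<infinity>p. F p)"
    using infsum_Sigma'_banach[OF s] infsum_reindex_bij_betw[OF bij, of F]
    by (simp add: case_prod_unfold)
qed

lemma convolution_summable:
  fixes f g :: "'s::times \<Rightarrow> complex"
  assumes f: "f abs_summable_on UNIV" and g: "g abs_summable_on UNIV"
  shows "(\<lambda>t. \<Sum>\<^sub>\<infinity>(r, s)\<in>{(r, s). r * s = t}. f r * g s) abs_summable_on UNIV" (is ?S)
    and "(\<Sum>\<^sub>\<infinity>t. norm (\<Sum>\<^sub>\<infinity>(r, s)\<in>{(r, s). r * s = t}. f r * g s))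
      \<le> (\<Sum>\<^sub>\<infinity>r. norm (f r)) * (\<Sum>\<^sub>\<infinity>s. norm (g s))" (is ?L)
proof -
  define F where "F = (\<lambda>p. norm (f (fst p) * g (snd p)))"
  define h where "h = (\<lambda>p :: 's \<times> 's. fst p * snd p)"
  have F: "F summable_on UNIV"
    using abs_summable_times(1)[OF f g] by (simp add: F_def case_prod_unfold)
  note fib = summable_fibres[OF F, of h]
  have le: "norm (\<Sum>\<^sub>\<infinity>(r, s)\<in>{(r, s). r * s = t}. f r * g s) \<le> (\<Sum>\<^sub>\<infinity>p\<in>{p. h p = t}. F p)" for t
    using norm_infsum_bound[of "\<lambda>p. f (fst p) * g (snd p)" "{p. h p = t}"]
      summable_on_subset_banach[OF F, of "{p. h p = t}"]
    by (simp add: F_def h_def case_prod_unfold)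
  show ?S by (rule summable_on_comparison_test[OF fib(1)]) (use le in auto)
  then have "(\<Sum>\<^sub>\<infinity>t. norm (\<Sum>\<^sub>\<infinity>(r, s)\<in>{(r, s). r * s = t}. f r * g s)) \<le> (\<Sum>\<^sub>\<infinity>p. F p)"
    unfolding fib(2)[symmetric] by (rule infsum_mono[OF _ fib(1)]) (use le in auto)
  also have "\<dots> = (\<Sum>\<^sub>\<infinity>r. norm (f r)) * (\<Sum>\<^sub>\<infinity>s. norm (g s))"
    using abs_summable_times(2)[OF f g] by (simp add: F_def case_prod_unfold)
  finally show ?L .
qed

lemma convolution_assoc:
  fixes f g k :: "'s::semigroup_mult \<Rightarrow> complex"
  assumes f: "f abs_summable_on UNIV" and g: "g abs_summable_on UNIV" and k: "k abs_summable_on UNIV"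
  shows "(\<Sum>\<^sub>\<infinity>(u, v)\<in>{(u, v). u * v = t}. (\<Sum>\<^sub>\<infinity>(r, s)\<in>{(r, s). r * s = u}. f r * g s) * k v) =
    (\<Sum>\<^sub>\<infinity>(u, v)\<in>{(u, v). u * v = t}. f u * (\<Sum>\<^sub>\<infinity>(r, s)\<in>{(r, s). r * s = v}. g r * k s))"
    (is "?L = ?R")
proof -
  define T where "T = (\<lambda>(r, s, v). f r * (g s * k v))"
  define A where "A = {(u :: 's, v). u * v = t}"
  define P where "P = {(r :: 's, s, v). r * (s * v) = t}"
  have "T abs_summable_on UNIV"
    using abs_summable_times(1)[OF f abs_summable_times(1)[OF g k]]
    by (simp add: T_def case_prod_unfold)
  then have TP: "T summable_on P"
    using summable_on_subset_banach abs_summable_summable by blast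
  let ?B = "\<lambda>p. {(r, s). r * s = fst p}" and ?B' = "\<lambda>p. {(r, s). r * s = snd p}"
  let ?b = "\<lambda>(p, q). (fst q, snd q, snd p)" and ?b' = "\<lambda>(p, q). (fst p, fst q, snd q)"
  have b: "bij_betw ?b (Sigma A ?B) P"
    by (rule bij_betw_byWitness[where f' = "\<lambda>(r, s, v). ((r * s, v), (r, s))"])
      (auto simp: A_def P_def mult.assoc)
  have b': "bij_betw ?b' (Sigma A ?B') P"
    by (rule bij_betw_byWitness[where f' = "\<lambda>(r, s, v). ((r, s * v), (s, v))"])
      (auto simp: A_def P_def mult.assoc)
  have s: "(\<lambda>(p, q). f (fst q) * g (snd q) * k (snd p)) summable_on Sigma A ?B"
    using summable_on_reindex_bij_betw[OF b, of T] TP by (simp add: T_def case_prod_unfold mult.assoc)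
  have s': "(\<lambda>(p, q). f (fst p) * (g (fst q) * k (snd q))) summable_on Sigma A ?B'"
    using summable_on_reindex_bij_betw[OF b', of T] TP by (simp add: T_def case_prod_unfold)
  have "?L = (\<Sum>\<^sub>\<infinity>p\<in>A. \<Sum>\<^sub>\<infinity>q\<in>?B p. f (fst q) * g (snd q) * k (snd p))"
    by (simp add: A_def case_prod_unfold infsum_cmult_left')
  also have "\<dots> = infsum T P"
    using infsum_Sigma'_banach[OF s] infsum_reindex_bij_betw[OF b, of T]
    by (simp add: T_def case_prod_unfold mult.assoc)
  also have "\<dots> = (\<Sum>\<^sub>\<infinity>p\<in>A. \<Sum>\<^sub>\<infinity>q\<in>?B' p. f (fst p) * (g (fst q) * k (snd q)))"
    using infsum_Sigma'_banach[OF s'] infsum_reindex_bij_betw[OF b', of T]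
    by (simp add: T_def case_prod_unfold)
  also have "\<dots> = ?R"
    by (simp add: A_def case_prod_unfold infsum_cmult_right')
  finally show ?thesis .
qed

instantiation ell1 :: (semigroup_mult) complex_banach_algebra
begin

lift_definition times_ell1 :: "'a ell1 \<Rightarrow> 'a ell1 \<Rightarrow> 'a ell1"
  is "\<lambda>f g t. \<Sum>\<^sub>\<infinity>(r, s)\<in>{(r, s). r * s = t}. f r * g s"
  by (rule convolution_summable(1))

instance
proof
  have summ: "(\<lambda>p. f (fst p) * g (snd p)) summable_on B"
    if "f abs_summable_on UNIV" "g abs_summable_on UNIV" for f g :: "'a \<Rightarrow> complex" and B
    using summable_on_subset_banach[OF abs_summable_summable[OF abs_summable_times(1)[OF that]], of B]
    by (simp add: case_prod_unfold)
  fix f g h :: "'a ell1" and c :: complex and r :: real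
  show "f * g * h = f * (g * h)" by transfer (intro ext convolution_assoc)
  show "(f + g) * h = f * h + g * h"
    by transfer (simp add: case_prod_unfold distrib_right infsum_add summ)
  show "f * (g + h) = f * g + f * h"
    by transfer (simp add: case_prod_unfold distrib_left infsum_add summ)
  show "norm (f * g) \<le> norm f * norm g"
    by transfer (rule convolution_summable(2))
  show L: "scaleC c f * g = scaleC c (f * g)" for c
    by transfer (simp add: case_prod_unfold mult.assoc infsum_cmult_right')
  show R: "f * scaleC c g = scaleC c (f * g)" for c
    by transfer (simp add: case_prod_unfold mult.left_commute infsum_cmult_right')
  show "r *\<^sub>R f * g = r *\<^sub>R (f * g)" unfolding scaleR_ell1_def by (rule L)
  show "f * r *\<^sub>R g = r *\<^sub>R (f * g)" unfolding scaleR_ell1_def by (rule R)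
qed

end

section \<open>The semigroup of a totally ordered set under maximum\<close>

datatype 'i vee = Vee (unVee: 'i)

instantiation vee :: (linorder) ab_semigroup_mult
begin

definition times_vee :: "'a vee \<Rightarrow> 'a vee \<Rightarrow> 'a vee"
  where "s * t = Vee (max (unVee s) (unVee t))"

instance
  by standard (simp_all add: times_vee_def max.assoc max.commute max.left_commute)

end

lift_definition point_mass :: "'s \<Rightarrow> 's ell1" is "\<lambda>t u. if u = t then 1 else 0"
proof -
  fix t :: 's
  have "(\<lambda>u. norm (if u = t then 1 else 0 :: complex)) summable_on UNIV"
    by (rule finite_nonzero_values_imp_summable_on) (auto intro: finite_subset[of _ "{t}"])
  then show "(\<lambda>u. if u = t then 1 else 0 :: complex) abs_summable_on UNIV" .
qed

lemma point_mass_mult: "point_mass s * point_mass t = point_mass (s * t)"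
proof (rule ell1_eqI)
  fix u
  have "ell1_fun (point_mass s * point_mass t) u =
      (\<Sum>\<^sub>\<infinity>p\<in>{(r, r'). r * r' = u}. if p = (s, t) then 1 else 0)"
    unfolding times_ell1.rep_eq point_mass.rep_eq
    by (rule infsum_cong) (simp split: prod.split)
  also have "\<dots> = (\<Sum>\<^sub>\<infinity>p\<in>{(r, r'). r * r' = u} \<inter> {(s, t)}. 1)"
    by (rule infsum_cong_neutral) auto
  also have "\<dots> = ell1_fun (point_mass (s * t)) u"
    by (auto simp: point_mass.rep_eq)
  finally show "ell1_fun (point_mass s * point_mass t) u = ell1_fun (point_mass (s * t)) u" .
qed

lemma point_mass_vee_mult:
  "point_mass (Vee s) * point_mass (Vee t) = point_mass (Vee (max s t))"
  by (simp add: point_mass_mult times_vee_def)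

end

theory Submission
  imports Defs
begin

text \<open>
  For \<open>t\<^sub>1 < \<dots> < t\<^sub>n\<close> the span of the point masses \<open>e t\<^sub>k\<close> has the unit \<open>u = e t\<^sub>1\<close> and the
  minimal idempotents \<open>p\<^sub>k = e t\<^sub>k - e t\<^sub>k\<^sub>+\<^sub>1\<close>, \<open>p\<^sub>n = e t\<^sub>n\<close>. On this span a derivation \<open>D\<close> is
  implemented by \<open>(\<Sum>k. p\<^sub>k \<cdot> D p\<^sub>k) - D u \<cdot> u\<close>, where the last term accounts for \<open>u\<close> not acting
  as a unit on the bimodule. This element is in general unbounded as the chain grows. But the
  diagonal \<open>\<Sum>k. p\<^sub>k \<otimes> p\<^sub>k\<close> almost commutes with every point mass \<open>e t\<close>: a single summand, the
  one with \<open>t\<^sub>k < t < t\<^sub>k\<^sub>+\<^sub>1\<close> (or \<open>k = n\<close>), contributes to the commutator. So the inner derivations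
  are uniformly bounded on point masses, hence on all of \<open>\<ell>\<^sup>1\<close>.
\<close>

section \<open>Derivations along a chain of idempotents\<close>

text \<open>Larger indices give smaller idempotents: \<open>e s\<close> is a unit for
  \<open>e t\<close> whenever \<open>s \<le> t\<close>, so the least index of a finite chain
  supplies the unit of its span.\<close>

locale chain_derivation = banach_bimodule lact ract
  for lact :: "'a::complex_banach_algebra \<Rightarrow> 'x::complex_banach \<Rightarrow> 'x"
    and ract :: "'x \<Rightarrow> 'a \<Rightarrow> 'x" +
  fixes D :: "'a \<Rightarrow> 'x" and e :: "'i::linorder \<Rightarrow> 'a"
  assumes deriv: "continuous_derivation lact ract D"
    and chain: "e s * e t = e (max s t)"
    and norm_chain: "norm (e t) \<le> 1"
begin

sublocale D: bounded_linear D
  using deriv by (simp add: continuous_derivation_def)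

lemma D_mult: "D (a * b) = lact a (D b) + ract (D a) b"
  using deriv by (simp add: continuous_derivation_def)

lemma norm_chain_diff: "norm (e s - e t) \<le> 2"
  using norm_triangle_ineq4[of "e s" "e t"] norm_chain[of s] norm_chain[of t] by linarith

text \<open>Vanishes when \<open>x\<close> implements \<open>D\<close> at \<open>a\<close> up to the failure of \<open>u\<close> to act as a left unit.\<close>

definition defect :: "'a \<Rightarrow> 'x \<Rightarrow> 'a \<Rightarrow> 'x"
  where "defect u x a = lact a x - ract x a - lact u (D a)"

text \<open>Apply the Leibniz rule to \<open>u * a\<close> and act by \<open>u\<close> from the
  left. The right-hand side vanishes once \<open>a * u\<close> and \<open>u * a\<close> are both
  \<open>u\<close> or both \<open>0\<close>, as for a minimal idempotent of a finite chain and a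
  member of that chain.\<close>

lemma defect_summand: "defect u (lact u (D u)) a = lact (a * u) (D u) - lact u (D (u * a))"
  if "u * u = u"
proof -
  have "lact u (D (u * a)) = lact u (lact u (D a)) + ract (lact u (D u)) a"
    by (simp add: D_mult lact.add_right lact_ract)
  also have "lact u (lact u (D a)) = lact u (D a)"
    using that by (metis lact_mult)
  finally show ?thesis by (simp add: defect_def lact_mult)
qed

text \<open>Lets the unit and the implementing element grow together when a chain is
  extended.\<close>

lemma defect_add: "defect (u + v) (x + y) a = defect u x a + defect v y a"
  by (simp add: defect_def lact.add_right lact.add_left ract.add_left)

text \<open>The radius 2 admits both the elements \<open>e t\<close> and their differences, so one
  constant serves all chains.\<close>

lemma norm_lact_D_bounded:
  obtains C where "0 \<le> C" "\<And>a b. norm a \<le> 2 \<Longrightarrow> norm b \<le> 2 \<Longrightarrow> norm (lact a (D b)) \<le> C"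
proof -
  obtain M where M: "0 < M" "\<And>a x. norm (lact a x) \<le> norm a * norm x * M"
    using lact.pos_bounded by metis
  obtain L where L: "0 < L" "\<And>a. norm (D a) \<le> norm a * L"
    using D.pos_bounded by metis
  show thesis
  proof (rule that[of "2 * (2 * L) * M"])
    fix a b :: 'a assume ab: "norm a \<le> 2" "norm b \<le> 2"
    have "norm (D b) \<le> 2 * L"
      using L ab(2) by (meson less_imp_le mult_right_mono order_trans)
    then have "norm a * norm (D b) * M \<le> 2 * (2 * L) * M"
      using ab(1) M(1) L(1) by (intro mult_mono) auto
    then show "norm (lact a (D b)) \<le> 2 * (2 * L) * M"
      using M(2) order_trans by blast
  qed (use M L in simp)
qed

text \<open>
  The bound is independent of the chain \<open>A\<close>: extending \<open>A\<close> by a new least element \<open>s\<close> changes the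
  defect only at the \<open>e t\<close> with \<open>s < t < Min A\<close>, where it vanished before.
\<close>

lemma approximate_implementation:
  assumes C: "0 \<le> C" "\<And>a b. norm a \<le> 2 \<Longrightarrow> norm b \<le> 2 \<Longrightarrow> norm (lact a (D b)) \<le> C"
    and "finite A" "A \<noteq> {}"
  shows "\<exists>x. \<forall>t. (t \<in> A \<or> t \<le> Min A \<longrightarrow> defect (e (Min A)) x (e t) = 0) \<and>
    norm (defect (e (Min A)) x (e t)) \<le> 2 * C"
  using assms(3,4)
proof (induction A rule: finite_linorder_min_induct)
  case empty
  then show ?case by simp
next
  case (insert s A)
  have bound: "norm (lact a (D b) - lact c (D d)) \<le> 2 * C"
    if "norm a \<le> 2" "norm b \<le> 2" "norm c \<le> 2" "norm d \<le> 2" for a b c d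
    using norm_triangle_ineq4[of "lact a (D b)" "lact c (D d)"] C(2)[of a b] C(2)[of c d] that
    by linarith
  show ?case
  proof (cases "A = {}")
    case True
    \<comment> \<open>For \<open>t \<le> s\<close> the two terms coincide; for \<open>t > s\<close>
      each has norm at most \<open>C\<close>.\<close>
    have "defect (e s) (lact (e s) (D (e s))) (e t)
        = lact (e (max t s)) (D (e s)) - lact (e s) (D (e (max s t)))" for t
      using defect_summand[of "e s" "e t"] by (simp add: chain)
    moreover have "norm (e t) \<le> 2" for t
      using norm_chain[of t] by linarith
    ultimately show ?thesis
      using True bound C(1) by (intro exI[of _ "lact (e s) (D (e s))"]) (auto simp: max_def)
  next
    case False
    define u where "u = Min A"
    \<comment> \<open>The minimal idempotent contributed by the new least index. Since
      \<open>e s = e u + p\<close>, \<open>defect_add\<close> isolates the change in the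
      defect.\<close>
    define p where "p = e s - e u"
    obtain x where x: "\<And>t. t \<in> A \<or> t \<le> u \<Longrightarrow> defect (e u) x (e t) = 0"
      "\<And>t. norm (defect (e u) x (e t)) \<le> 2 * C"
      using insert.IH False unfolding u_def by blast
    have "u \<in> A" and min: "\<And>t. t \<in> A \<Longrightarrow> u \<le> t"
      using insert.hyps(1) False by (simp_all add: u_def)
    then have su: "s < u" using insert.hyps(2) by blast
    have Min: "Min (insert s A) = s"
      using insert.hyps(1,2) by (intro Min_eqI) (auto simp: less_imp_le)
    have idem: "p * p = p"
      using su by (simp add: p_def chain algebra_simps max.absorb1 max.absorb2 less_imp_le)
    have new: "defect (e s) (x + lact p (D p)) a = defect (e u) x a + (lact (a * p) (D p) - lact p (D (p * a)))" for a
      using defect_add[of "e u" p x "lact p (D p)" a] defect_summand[OF idem, of a]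
      by (simp add: p_def)
    have ap: "e t * p = e (max t s) - e (max t u)" "p * e t = e (max t s) - e (max t u)" for t
      by (simp_all add: p_def algebra_simps chain max.commute)
    \<comment> \<open>\<open>e t\<close> fixes \<open>p\<close> if \<open>t \<le> s\<close> and
      annihilates it if \<open>u \<le> t\<close>; the change vanishes either way.\<close>
    have outside: "defect (e s) (x + lact p (D p)) (e t) = defect (e u) x (e t)" if "t \<le> s \<or> u \<le> t" for t
    proof -
      have "e t * p = p \<and> p * e t = p \<or> e t * p = 0 \<and> p * e t = 0"
        using that su unfolding ap by (auto simp: p_def max_def)
      then show ?thesis unfolding new by (auto simp: lact.zero_left lact.zero_right D.zero)
    qed
    \<comment> \<open>Here the old defect is zero and only the new difference remains, so the bound
      does not accumulate along the induction.\<close>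
    have inside: "norm (defect (e s) (x + lact p (D p)) (e t)) \<le> 2 * C" if "t \<le> u" for t
      unfolding new x(1)[OF disjI2[OF that]] ap by (simp add: bound p_def norm_chain_diff)
    show ?thesis
      unfolding Min
    proof (intro exI[of _ "x + lact p (D p)"] allI conjI impI)
      fix t assume "t \<in> insert s A \<or> t \<le> s"
      then have "(t \<le> s \<or> u \<le> t) \<and> (t \<in> A \<or> t \<le> u)" using su min by auto
      then show "defect (e s) (x + lact p (D p)) (e t) = 0"
        using outside x(1) by simp
    next
      fix t show "norm (defect (e s) (x + lact p (D p)) (e t)) \<le> 2 * C"
        using inside[of t] outside[of t] x(2)[of t] by (cases "t \<le> u") (auto simp: not_le less_imp_le)
    qed
  qed
qed

text \<open>The correction \<open>ract (D u) u\<close> turns zero defect on \<open>A\<close> into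
  exact implementation there. Its contribution is bounded through \<open>D\<close> and the actions
  alone, so \<open>K\<close> does not depend on \<open>A\<close>.\<close>

lemma implementation:
  obtains K where "0 \<le> K"
    "\<And>A. finite A \<Longrightarrow> \<exists>z. (\<forall>t\<in>A. lact (e t) z - ract z (e t) = D (e t)) \<and>
      (\<forall>t. norm (lact (e t) z - ract z (e t)) \<le> K)"
proof -
  obtain C where C: "0 \<le> C" "\<And>a b. norm a \<le> 2 \<Longrightarrow> norm b \<le> 2 \<Longrightarrow> norm (lact a (D b)) \<le> C"
    using norm_lact_D_bounded by metis
  obtain M where M: "0 < M" "\<And>x a. norm (ract x a) \<le> norm x * norm a * M"
    using ract.pos_bounded by metis
  have R: "norm (ract x (e t)) \<le> norm x * M" for x t
  proof -
    have "norm x * norm (e t) * M \<le> norm x * 1 * M"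
      using M(1) norm_chain by (intro mult_mono) auto
    then show ?thesis using M(2)[of x "e t"] by simp
  qed
  obtain L where L: "0 < L" "\<And>a. norm (D a) \<le> norm a * L"
    using D.pos_bounded by metis
  have nD: "norm (D (e t)) \<le> L" for t
    using L(2)[of "e t"] mult_right_mono[OF norm_chain[of t], of L] L(1) by linarith
  \<comment> \<open>One summand for each term of \<open>eq\<close> below, in the same order.\<close>
  define K where "K = 2 * C + C + C * M + L * M"
  have "\<exists>z. (\<forall>t\<in>A. lact (e t) z - ract z (e t) = D (e t)) \<and>
      (\<forall>t. norm (lact (e t) z - ract z (e t)) \<le> K)" if "finite A" for A
  proof (cases "A = {}")
    case True
    then show ?thesis using C(1) M(1) L(1)
      by (intro exI[of _ 0]) (simp add: lact.zero_right ract.zero_left K_def)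
  next
    case False
    define u where "u = e (Min A)"
    obtain x where x: "\<And>t. t \<in> A \<Longrightarrow> defect u x (e t) = 0"
      "\<And>t. norm (defect u x (e t)) \<le> 2 * C"
      using approximate_implementation[OF C \<open>finite A\<close> False] unfolding u_def by blast
    define z where "z = x - ract (D u) u"
    have eq: "lact (e t) z - ract z (e t) =
        defect u x (e t) + lact u (D (e t)) - ract (lact (e t) (D u)) u + ract (D u) (u * e t)" for t
      by (simp add: z_def defect_def lact.diff_right ract.diff_left lact_ract ract_mult)
    have "lact (e t) z - ract z (e t) = D (e t)" if "t \<in> A" for t
    proof -
      have "Min A \<le> t" using \<open>finite A\<close> that by simp
      then have ut: "u * e t = e t" "e t * u = e t" "u * u = u"
        by (simp_all add: u_def chain max_def)
      \<comment> \<open>Acting by \<open>u\<close> from the left on this identity gives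
        \<open>lact u (ract (D u) u) = 0\<close>; since \<open>e t = e t * u\<close>, also
        \<open>e t\<close> annihilates the correction.\<close>
      have "D u = lact u (D u) + ract (D u) u"
        using D_mult[of u u] ut by simp
      then have "lact u (D u) = lact u (D u) + lact u (ract (D u) u)"
        using lact.add_right[of u "lact u (D u)" "ract (D u) u"] lact_mult[of u u "D u"] ut
        by simp
      then have "lact (e t) (ract (D u) u) = 0"
        using lact_mult[of "e t" u "ract (D u) u"] ut by (simp add: lact.zero_right)
      moreover have "D (e t) = lact u (D (e t)) + ract (D u) (e t)"
        using D_mult[of u "e t"] ut by simp
      ultimately show ?thesis unfolding eq using x(1)[OF that] ut(1) by (simp add: lact_ract)
    qed
    moreover have "norm (lact (e t) z - ract z (e t)) \<le> K" for t
    proof -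
      have small: "norm (e s) \<le> 2" for s using norm_chain[of s] by linarith
      have "norm (lact u (D (e t))) \<le> C" "norm (lact (e t) (D u)) \<le> C"
        using C(2) small by (simp_all add: u_def)
      moreover from this(2) have "norm (ract (lact (e t) (D u)) u) \<le> C * M"
        using R[of "lact (e t) (D u)" "Min A"] mult_right_mono[of _ C M] M(1)
        unfolding u_def by (meson less_imp_le order_trans)
      moreover have "norm (ract (D u) (u * e t)) \<le> L * M"
        using R[of "D u"] mult_right_mono[OF nD[of "Min A"], of M] M(1)
        unfolding u_def chain by (meson less_imp_le order_trans)
      ultimately show ?thesis
        unfolding eq K_def using x(2)[of t]
        by (smt (verit) norm_triangle_ineq norm_triangle_ineq4)
    qed
    ultimately show ?thesis by blast
  qed
  moreover have "0 \<le> K" using C(1) M(1) L(1) by (simp add: K_def)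
  ultimately show thesis using that by blast
qed

end

section \<open>Point masses span a dense subspace\<close>

lemma norm_point_mass: "norm (point_mass t) = 1"
proof -
  have "norm (point_mass t) = (\<Sum>\<^sub>\<infinity>u\<in>{t}. 1)"
    unfolding norm_ell1.rep_eq point_mass.rep_eq by (rule infsum_cong_neutral) auto
  then show ?thesis by simp
qed

lemma ell1_fun_sum: "ell1_fun (\<Sum>i\<in>F. g i) t = (\<Sum>i\<in>F. ell1_fun (g i) t)"
  by (induction F rule: infinite_finite_induct) (simp_all add: zero_ell1.rep_eq plus_ell1.rep_eq)

text \<open>Subtracting the partial sum over \<open>F\<close> leaves \<open>f\<close> restricted to
  the complement of \<open>F\<close>, whose norm is the tail of a convergent series.\<close>

lemma has_sum_point_masses: "((\<lambda>t. scaleC (ell1_fun f t) (point_mass t)) has_sum f) UNIV"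
proof -
  have co: "ell1_fun (f - (\<Sum>t\<in>F. scaleC (ell1_fun f t) (point_mass t))) s
      = (if s \<in> F then 0 else ell1_fun f s)" if "finite F" for F s
    using that by (simp add: ell1_fun_diff ell1_fun_sum scaleC_ell1.rep_eq point_mass.rep_eq
        if_distrib[of "\<lambda>x. _ * x"] sum.delta cong: if_cong)
  have nf: "norm (f - (\<Sum>t\<in>F. scaleC (ell1_fun f t) (point_mass t)))
      = norm f - (\<Sum>t\<in>F. norm (ell1_fun f t))" if "finite F" for F
  proof -
    have "norm (f - (\<Sum>t\<in>F. scaleC (ell1_fun f t) (point_mass t)))
        = (\<Sum>\<^sub>\<infinity>s\<in>UNIV - F. norm (ell1_fun f s))"
      unfolding norm_ell1.rep_eq co[OF that] by (rule infsum_cong_neutral) auto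
    also have "\<dots> = norm f - (\<Sum>t\<in>F. norm (ell1_fun f t))"
      using infsum_Diff[of "\<lambda>t. norm (ell1_fun f t)" UNIV F] that
      by (simp add: norm_ell1.rep_eq ell1_summable)
    finally show ?thesis .
  qed
  have "((\<lambda>t. norm (ell1_fun f t)) has_sum norm f) UNIV"
    unfolding norm_ell1.rep_eq by (rule has_sum_infsum) (rule ell1_summable)
  then have "((\<lambda>F. norm f - (\<Sum>t\<in>F. norm (ell1_fun f t))) \<longlongrightarrow> norm f - norm f) (finite_subsets_at_top UNIV)"
    unfolding has_sum_def by (intro tendsto_intros)
  then have "((\<lambda>F. norm (f - (\<Sum>t\<in>F. scaleC (ell1_fun f t) (point_mass t)))) \<longlongrightarrow> 0) (finite_subsets_at_top UNIV)"
    unfolding diff_self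
    by (rule Lim_transform_eventually) (auto intro!: eventually_finite_subsets_at_top_weakI simp: nf)
  then show ?thesis
    unfolding has_sum_def tendsto_iff dist_norm by (simp add: norm_minus_commute)
qed

text \<open>The triangle inequality bounds the image of every finite partial sum of the point mass
  expansion, and the bound passes to the limit.\<close>

lemma norm_le_of_point_masses:
  fixes T :: "'s ell1 \<Rightarrow> 'x::complex_banach"
  assumes T: "bounded_linear T" "\<And>c f. T (scaleC c f) = scaleC c (T f)"
    and K: "0 \<le> K" "\<And>t. norm (T (point_mass t)) \<le> K"
  shows "norm (T f) \<le> K * norm f"
proof (rule tendsto_upperbound[OF tendsto_norm])
  show "((\<lambda>F. \<Sum>t\<in>F. T (scaleC (ell1_fun f t) (point_mass t))) \<longlongrightarrow> T f) (finite_subsets_at_top UNIV)"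
    using has_sum_bounded_linear[OF T(1) has_sum_point_masses[of f]] by (simp add: has_sum_def)
  have "norm (\<Sum>t\<in>F. T (scaleC (ell1_fun f t) (point_mass t))) \<le> K * norm f" if "finite F" for F
  proof -
    have "norm (\<Sum>t\<in>F. T (scaleC (ell1_fun f t) (point_mass t))) \<le> (\<Sum>t\<in>F. K * norm (ell1_fun f t))"
      unfolding T(2) by (rule sum_norm_le) (simp add: norm_scaleC mult.commute[of K] mult_left_mono K(2))
    also have "\<dots> \<le> K * norm f"
      unfolding sum_distrib_left[symmetric] using sum_norm_le_norm_ell1[OF that] K(1) by (rule mult_left_mono)
    finally show ?thesis .
  qed
  then show "\<forall>\<^sub>F F in finite_subsets_at_top UNIV.
      norm (\<Sum>t\<in>F. T (scaleC (ell1_fun f t) (point_mass t))) \<le> K * norm f"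
    by (intro eventually_finite_subsets_at_top_weakI)
qed simp

section \<open>Bounded approximate contractibility\<close>

text \<open>A uniform bound on point masses is a uniform operator bound, and exact agreement on
  finite sets of point masses then gives pointwise convergence by density.\<close>

lemma boundedly_approx_contractible_ell1I:
  assumes "\<And>(lact :: 's::semigroup_mult ell1 \<Rightarrow> 'x::complex_banach \<Rightarrow> 'x) ract D.
      banach_bimodule lact ract \<Longrightarrow> continuous_derivation lact ract D \<Longrightarrow>
      \<exists>K\<ge>0. \<forall>A. finite A \<longrightarrow> (\<exists>z.
        (\<forall>t\<in>A. lact (point_mass t) z - ract z (point_mass t) = D (point_mass t)) \<and>
        (\<forall>t. norm (lact (point_mass t) z - ract z (point_mass t)) \<le> K))"
  shows "boundedly_approx_contractible TYPE('s ell1) TYPE('x)"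
  unfolding boundedly_approx_contractible_def
proof (intro allI impI)
  fix lact :: "'s ell1 \<Rightarrow> 'x \<Rightarrow> 'x" and ract D
  assume bimod: "banach_bimodule lact ract" and der: "continuous_derivation lact ract D"
  interpret banach_bimodule lact ract by (fact bimod)
  have D: "bounded_linear D" "D (scaleC c a) = scaleC c (D a)" for c a
    using der by (simp_all add: continuous_derivation_def)
  obtain K where K: "0 \<le> K" "\<And>A. finite A \<Longrightarrow> \<exists>z.
        (\<forall>t\<in>A. lact (point_mass t) z - ract z (point_mass t) = D (point_mass t)) \<and>
        (\<forall>t. norm (lact (point_mass t) z - ract z (point_mass t)) \<le> K)"
    using assms[OF bimod der] by blast
  define ad where "ad z a = lact a z - ract z a" for z a
  have lin: "bounded_linear (ad z)" for z
    unfolding ad_def by (intro bounded_linear_sub lact.bounded_linear_left ract.bounded_linear_right)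
  have adC: "ad z (scaleC c a) = scaleC c (ad z a)" for z c a
  proof -
    have "scaleC c (lact a z) = scaleC c (ad z a) + scaleC c (ract z a)"
      by (simp add: ad_def flip: scaleC_add_right)
    then show ?thesis by (simp add: ad_def lact_scaleC_left ract_scaleC_right)
  qed
  have "\<exists>z. (\<forall>t. point_mass t \<in> S \<longrightarrow> ad z (point_mass t) = D (point_mass t)) \<and>
      (\<forall>t. norm (ad z (point_mass t)) \<le> K)" if "finite S" for S
  proof -
    obtain A where A: "finite A" "S \<inter> range point_mass = point_mass ` A"
      using \<open>finite S\<close> finite_subset_image[of "S \<inter> range point_mass" point_mass UNIV] by auto
    from K(2)[OF A(1)] obtain z where z: "\<forall>t\<in>A. ad z (point_mass t) = D (point_mass t)"
      "\<forall>t. norm (ad z (point_mass t)) \<le> K"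
      unfolding ad_def by blast
    have "ad z (point_mass t) = D (point_mass t)" if "point_mass t \<in> S" for t
    proof -
      have "point_mass t \<in> point_mass ` A" using that A(2) by blast
      then show ?thesis using z(1) by auto
    qed
    then show ?thesis using z(2) by blast
  qed
  then obtain z where z: "\<And>S t. finite S \<Longrightarrow> point_mass t \<in> S \<Longrightarrow> ad (z S) (point_mass t) = D (point_mass t)"
      "\<And>S t. finite S \<Longrightarrow> norm (ad (z S) (point_mass t)) \<le> K"
    by metis
  have adK: "norm (ad (z S) a) \<le> K * norm a" if "finite S" for S a
    by (rule norm_le_of_point_masses[OF lin adC K(1) z(2)[OF that]])
  obtain L where L: "0 < L" "\<And>a. norm (D a) \<le> norm a * L"
    using bounded_linear.pos_bounded[OF D(1)] by metis
  \<comment> \<open>The \<open>nat\<close> component is held at \<open>0\<close>: agreement on point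
    masses is exact, so there is no error tolerance to index.\<close>
  define J where "J = {S :: 's ell1 set. finite S} \<times> {0 :: nat}"
  define le where "le = (\<lambda>(i :: 's ell1 set \<times> nat) (j :: 's ell1 set \<times> nat). fst i \<subseteq> fst j)"
  define N where "N = (\<lambda>j :: 's ell1 set \<times> nat. ad (z (fst j)))"
  have dir: "directed_set J le"
    unfolding directed_set_def
  proof (intro conjI ballI)
    fix i j assume "i \<in> J" "j \<in> J"
    then show "\<exists>k\<in>J. le i k \<and> le j k"
      by (intro bexI[of _ "(fst i \<union> fst j, 0)"]) (auto simp: J_def le_def)
  qed (auto simp: J_def le_def)
  have inner: "\<forall>j\<in>J. inner_derivation lact ract (N j)"
    by (auto simp: inner_derivation_def N_def ad_def)
  have bdd: "\<forall>j\<in>J. onorm (N j) \<le> K"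
    by (auto simp: J_def N_def intro!: onorm_bound K(1) adK)
  have conv: "net_tendsto J le (\<lambda>j. N j a) (D a)" for a
    unfolding net_tendsto_def
  proof (intro allI impI)
    fix e :: real assume "e > 0"
    \<comment> \<open>\<open>N j\<close> and \<open>D\<close> agree on the truncation
      \<open>b\<close> below, so the error at \<open>a\<close> is that at \<open>a - b\<close>, at
      most \<open>(K + L) * norm (a - b)\<close>.\<close>
    define d where "d = e / (K + L)"
    have "d > 0" using \<open>e > 0\<close> K(1) L(1) by (simp add: d_def)
    then obtain F where F: "finite F" "dist (\<Sum>t\<in>F. scaleC (ell1_fun a t) (point_mass t)) a < d"
      using has_sum_point_masses[of a] unfolding has_sum_def tendsto_iff eventually_finite_subsets_at_top
      by blast
    define b where "b = (\<Sum>t\<in>F. scaleC (ell1_fun a t) (point_mass t))"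
    have "norm (N j a - D a) < e" if "j \<in> J" "le (point_mass ` F, 0) j" for j
    proof -
      have S: "finite (fst j)" "point_mass ` F \<subseteq> fst j"
        using that by (auto simp: J_def le_def)
      have "N j b = D b"
        unfolding b_def N_def linear_sum[OF bounded_linear.linear[OF lin]]
          linear_sum[OF bounded_linear.linear[OF D(1)]] adC D(2)
        by (rule sum.cong) (use S z(1)[OF S(1)] in auto)
      then have "N j a - D a = N j (a - b) - D (a - b)"
        by (simp add: N_def linear_diff[OF bounded_linear.linear[OF lin]]
            linear_diff[OF bounded_linear.linear[OF D(1)]])
      also have "norm \<dots> \<le> (K + L) * norm (a - b)"
        using norm_triangle_ineq4[of "N j (a - b)" "D (a - b)"] adK[OF S(1), of "a - b"] L(2)[of "a - b"]
        by (simp add: N_def algebra_simps)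
      also have "\<dots> < (K + L) * d"
        using F(2) K(1) L(1) by (simp add: b_def dist_norm norm_minus_commute)
      also have "\<dots> = e" using K(1) L(1) by (simp add: d_def)
      finally show ?thesis .
    qed
    moreover have "(point_mass ` F, 0) \<in> J" using F(1) by (simp add: J_def)
    ultimately show "\<exists>i\<in>J. \<forall>j\<in>J. le i j \<longrightarrow> norm (N j a - D a) < e" by blast
  qed
  show "\<exists>(J :: ('s ell1 set \<times> nat) set) le (N :: 's ell1 set \<times> nat \<Rightarrow> 's ell1 \<Rightarrow> 'x).
        directed_set J le \<and>
        (\<forall>j\<in>J. inner_derivation lact ract (N j)) \<and>
        (\<exists>K. \<forall>j\<in>J. onorm (N j) \<le> K) \<and>
        (\<forall>a. net_tendsto J le (\<lambda>j. N j a) (D a))"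
    using dir inner bdd conv by blast
qed

theorem theorem6p1:
  shows "boundedly_approx_contractible
    TYPE('i::linorder vee ell1) TYPE('x::complex_banach)"
proof (rule boundedly_approx_contractible_ell1I)
  fix lact :: "'i vee ell1 \<Rightarrow> 'x \<Rightarrow> 'x" and ract D
  assume bimod: "banach_bimodule lact ract" and der: "continuous_derivation lact ract D"
  \<comment> \<open>The chain is indexed by \<open>'i\<close>, which carries the order;
    \<open>'i vee\<close> carries the product.\<close>
  interpret chain_derivation lact ract D "\<lambda>t. point_mass (Vee t)"
    by (intro chain_derivation.intro bimod chain_derivation_axioms.intro der)
      (simp_all add: point_mass_vee_mult norm_point_mass)
  obtain K where K: "0 \<le> K" "\<And>A. finite A \<Longrightarrow> \<exists>z.
        (\<forall>t\<in>A. lact (point_mass (Vee t)) z - ract z (point_mass (Vee t)) = D (point_mass (Vee t))) \<and>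
        (\<forall>t. norm (lact (point_mass (Vee t)) z - ract z (point_mass (Vee t))) \<le> K)"
    using implementation by metis
  show "\<exists>K\<ge>0. \<forall>A. finite A \<longrightarrow> (\<exists>z.
        (\<forall>t\<in>A. lact (point_mass t) z - ract z (point_mass t) = D (point_mass t)) \<and>
        (\<forall>t. norm (lact (point_mass t) z - ract z (point_mass t)) \<le> K))"
  proof (intro exI[of _ K] conjI K(1) allI impI)
    fix A :: "'i vee set" assume "finite A"
    then obtain z where "\<forall>t\<in>unVee ` A. lact (point_mass (Vee t)) z - ract z (point_mass (Vee t)) = D (point_mass (Vee t))"
        "\<forall>t. norm (lact (point_mass (Vee t)) z - ract z (point_mass (Vee t))) \<le> K"
      using K(2)[of "unVee ` A"] by blast
    then show "\<exists>z. (\<forall>t\<in>A. lact (point_mass t) z - ract z (point_mass t) = D (point_mass t)) \<and>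
        (\<forall>t. norm (lact (point_mass t) z - ract z (point_mass t)) \<le> K)"
      by (metis imageI vee.collapse)
  qed
qed

end
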